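(* Let $n\ge 0$. If $xy=u_1u_2$ and $x+y=u_3+u_4$, then $$A_n(x,y,t\,|\,\alpha)=\sum_{\sigma\in\mathfrak{S}_{n+1}}(u_1u_2)^{\mathrm{val}(\sigma)}u_3^{\mathrm{da}(\sigma)}u_4^{\mathrm{dd}(\sigma)}t^{\mathrm{lmaxda}(\sigma)+\mathrm{rmaxdd}(\sigma)}\alpha^{\mathrm{lmax}(\sigma)+\mathrm{rmax}(\sigma)-2}.$$
   Context: $\mathfrak{S}_m$ is the symmetric group on $[m]$; permutations are written as words $\sigma=\sigma_1\cdots\sigma_m$. $\mathrm{asc}$ (resp. $\mathrm{des}$) is the number of $1\le i\le m-1$ with $\sigma_i<\sigma_{i+1}$ (resp. $\sigma_i>\sigma_{i+1}$). With the convention $\sigma_0=\sigma_{m+1}=0$, a letter $\sigma_i$ ($1\le i\le m$) is a valley if $\sigma_{i-1}>\sigma_i<\sigma_{i+1}$, a double ascent if $\sigma_{i-1}<\sigma_i<\sigma_{i+1}$, a double descent if $\sigma_{i-1}>\sigma_i>\sigma_{i+1}$; their numbers are $\mathrm{val},\mathrm{da},\mathrm{dd}$. $\sigma_i$ is a left-to-right (resp. right-to-left) maximum if it is larger than all letters of $\sigma$ to its left (resp. right); $\mathrm{lmax},\mathrm{rmax}$ are their numbers. $\mathrm{lmaxda}$ is the number of left-to-right maxima that are double ascents and $\mathrm{rmaxdd}$ the number of right-to-left maxima that are double descents. The $(\alpha,t)$-Eulerian polynomials are $$A_n(x,y,t\,|\,\alpha)=\sum_{\sigma\in\mathfrak{S}_{n+1}}x^{\mathrm{asc}(\sigma)}y^{\mathrm{des}(\sigma)}t^{\mathrm{lmaxda}(\sigma)+\mathrm{rmaxdd}(\sigma)}\alpha^{\mathrm{lmax}(\sigma)+\mathrm{rmax}(\sigma)-2}.$$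 All letters $x,y,u_i,t,\alpha$ are commuting variables. *)

theory Defs
  imports "HOL-Combinatorics.Multiset_Permutations"
begin

text \<open>
  A permutation of \<open>{1..m}\<close> is written as a word, i.e. as an element of
  \<open>permutations_of_set {1..m}\<close>.  The positions of a word are counted from \<open>1\<close>, and
  \<open>letter w i\<close> is its \<open>i\<close>-th letter, with the convention that the letters at the
  positions \<open>0\<close> and \<open>length w + 1\<close> are \<open>0\<close>.
\<close>

definition letter :: "nat list \<Rightarrow> nat \<Rightarrow> nat" where
  "letter w i = (0 # w @ [0]) ! i"

definition asc :: "nat list \<Rightarrow> nat" where
  "asc w = card {i. 1 \<le> i \<and> i < length w \<and> letter w i < letter w (i + 1)}"

definition des :: "nat list \<Rightarrow> nat" where
  "des w = card {i. 1 \<le> i \<and> i < length w \<and> letter w i > letter w (i + 1)}"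

text \<open>
  The following predicates refer to the letter at a position \<open>i \<in> {1..length w}\<close>.
\<close>

definition is_valley :: "nat list \<Rightarrow> nat \<Rightarrow> bool" where
  "is_valley w i \<longleftrightarrow> letter w (i - 1) > letter w i \<and> letter w i < letter w (i + 1)"

definition is_double_ascent :: "nat list \<Rightarrow> nat \<Rightarrow> bool" where
  "is_double_ascent w i \<longleftrightarrow> letter w (i - 1) < letter w i \<and> letter w i < letter w (i + 1)"

definition is_double_descent :: "nat list \<Rightarrow> nat \<Rightarrow> bool" where
  "is_double_descent w i \<longleftrightarrow> letter w (i - 1) > letter w i \<and> letter w i > letter w (i + 1)"

definition is_lr_max :: "nat list \<Rightarrow> nat \<Rightarrow> bool" where
  "is_lr_max w i \<longleftrightarrow> (\<forall>j. 1 \<le> j \<and> j < i \<longrightarrow> letter w j < letter w i)"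

definition is_rl_max :: "nat list \<Rightarrow> nat \<Rightarrow> bool" where
  "is_rl_max w i \<longleftrightarrow> (\<forall>j. i < j \<and> j \<le> length w \<longrightarrow> letter w j < letter w i)"

definition val :: "nat list \<Rightarrow> nat" where
  "val w = card {i \<in> {1..length w}. is_valley w i}"

definition da :: "nat list \<Rightarrow> nat" where
  "da w = card {i \<in> {1..length w}. is_double_ascent w i}"

definition dd :: "nat list \<Rightarrow> nat" where
  "dd w = card {i \<in> {1..length w}. is_double_descent w i}"

definition lmax :: "nat list \<Rightarrow> nat" where
  "lmax w = card {i \<in> {1..length w}. is_lr_max w i}"

definition rmax :: "nat list \<Rightarrow> nat" where
  "rmax w = card {i \<in> {1..length w}. is_rl_max w i}"

definition lmaxda :: "nat list \<Rightarrow> nat" where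
  "lmaxda w = card {i \<in> {1..length w}. is_lr_max w i \<and> is_double_ascent w i}"

definition rmaxdd :: "nat list \<Rightarrow> nat" where
  "rmaxdd w = card {i \<in> {1..length w}. is_rl_max w i \<and> is_double_descent w i}"

text \<open>
  The polynomial is given by its values at arbitrary elements of a commutative ring, the
  indeterminates of a polynomial ring being a special case.  The truncated subtraction in
  the last exponent is harmless: the largest letter of a nonempty word with distinct
  letters is both a left-to-right and a right-to-left maximum.
\<close>

definition alpha_t_eulerian :: "nat \<Rightarrow> 'a::comm_ring_1 \<Rightarrow> 'a \<Rightarrow> 'a \<Rightarrow> 'a \<Rightarrow> 'a" where
  "alpha_t_eulerian n x y t \<alpha> =
     (\<Sum>w\<in>permutations_of_set {1..n + 1}.
        x ^ asc w * y ^ des w * t ^ (lmaxda w + rmaxdd w) * \<alpha> ^ (lmax w + rmax w - 2))"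

end

theory Submission
  imports Defs "HOL-Computational_Algebra.Formal_Power_Series"
begin

text \<open>
  An ascent of a word has a valley or a double ascent at its left end, and a descent has a
  valley or a double descent at its right end.  So \<open>asc = val + da\<close> and \<open>des = val + dd\<close>
  (\<open>asc_eq_val_plus_da\<close>, \<open>des_eq_val_plus_dd\<close>), and both sides of the theorem are values of
  one sum: every valley has weight \<open>p\<close>, every double ascent \<open>u\<close>, every double descent \<open>u'\<close>,
  with an additional factor \<open>t\<close> for those that are left-to-right or right-to-left maxima,
  respectively.  It has to be shown that this sum depends on \<open>u\<close> and \<open>u'\<close> only through
  \<open>u + u'\<close>.

  All words arise by inserting letters in decreasing order, each new letter being smaller
  than all present ones.  A new letter at the left or right end is a double ascent and
  left-to-right maximum, or a double descent and right-to-left maximum; in both cases the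
  other letters keep their types.  A new letter in an interior gap is a valley, and exactly
  one neighbour changes its type: the left end of an ascent or the right end of a descent,
  which is a valley, a double ascent or a double descent.  A valley is hit from its two sides
  and becomes once a double ascent and once a double descent; a double ascent or double
  descent is hit once and becomes a peak, whether or not it is an extremal maximum.  Give the
  left-to-right maximal double ascents the weight \<open>c\<close> and the right-to-left maximal double
  descents the weight \<open>c'\<close>.  If \<open>D\<close> is a derivation with \<open>D \<alpha> = 0\<close>, \<open>D p = u + u'\<close> and
  \<open>D u = D u' = D c = D c' = 1\<close>, then the interior insertions multiply the weight by \<open>p\<close> after
  applying \<open>D\<close>, and the sums \<open>F\<^sub>n\<close> of the weights satisfy
  \<open>F\<^sub>n\<^sub>+\<^sub>1 = \<alpha> * (c + c') * F\<^sub>n + p * D F\<^sub>n\<close> (\<open>sum_word_weight_insert\<close>, \<open>sum_word_weight\<close>).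

  This recurrence mentions \<open>u\<close> and \<open>u'\<close> only through \<open>D\<close>.  In the ring of power series in
  one variable \<open>X\<close> with \<open>D = d/dX\<close>, the weights \<open>u + X\<close>, \<open>u' + X\<close>, \<open>t * u + X\<close>,
  \<open>t * u' + X\<close> and \<open>p + (u + u') * X + X\<^sup>2\<close> meet the requirements and specialise at \<open>X = 0\<close>
  to the given ones.  The valley weight and the sum \<open>c + c' = t * (u + u') + 2 * X\<close> involve
  only \<open>u + u'\<close>, hence so does every \<open>F\<^sub>n\<close> (\<open>weighted_sum_eq_eulerian_fps\<close>).
\<close>

section \<open>Inserting a new smallest letter\<close>

definition insert_letter :: "nat \<Rightarrow> nat \<Rightarrow> nat list \<Rightarrow> nat list" where
  "insert_letter j b w = take j w @ b # drop j w"

definition shift_pos :: "nat \<Rightarrow> nat \<Rightarrow> nat" where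
  "shift_pos j i = (if i \<le> j then i else Suc i)"

lemma length_insert_letter [simp]: "length (insert_letter j b w) = Suc (length w)"
  by (simp add: insert_letter_def)

lemma set_insert_letter [simp]: "set (insert_letter j b w) = insert b (set w)"
proof -
  have "set (take j w) \<union> set (drop j w) = set w"
    by (metis append_take_drop_id set_append)
  then show ?thesis by (auto simp: insert_letter_def)
qed

lemma bij_betw_insert_letter:
  assumes "finite S" "b \<notin> S"
  shows "bij_betw (\<lambda>(w, j). insert_letter j b w)
    (permutations_of_set S \<times> {..card S}) (permutations_of_set (insert b S))"
proof (rule bij_betw_imageI)
  show "inj_on (\<lambda>(w, j). insert_letter j b w) (permutations_of_set S \<times> {..card S})"
  proof (rule inj_onI, clarsimp)
    fix w j w' j'
    assume w: "w \<in> permutations_of_set S" "w' \<in> permutations_of_set S"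
      and j: "j \<le> card S" "j' \<le> card S"
      and eq: "insert_letter j b w = insert_letter j' b w'"
    have nb: "b \<notin> set w" "b \<notin> set w'"
      using w assms by (auto dest: permutations_of_setD)
    then have "b \<notin> set (take j w)" "b \<notin> set (take j' w')"
      "b \<notin> set (drop j w)" "b \<notin> set (drop j' w')"
      by (meson in_set_takeD in_set_dropD)+
    then have *: "take j w = take j' w'" "drop j w = drop j' w'"
      using eq by (auto simp: insert_letter_def append_Cons_eq_iff)
    then have "w = w'"
      by (metis append_take_drop_id)
    moreover have "length (take j w) = length (take j' w')"
      using * by simp
    then have "j = j'"
      using w j by (simp add: length_finite_permutations_of_set)
    ultimately show "w = w' \<and> j = j'" by simp
  qed
next
  show "(\<lambda>(w, j). insert_letter j b w) ` (permutations_of_set S \<times> {..card S})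
    = permutations_of_set (insert b S)" (is "?L = ?R")
  proof
    show "?L \<subseteq> ?R"
    proof clarsimp
      fix w j assume w: "w \<in> permutations_of_set S"
      then have "distinct w" "set w = S" by (auto dest: permutations_of_setD)
      then have "distinct (insert_letter j b w)"
        using assms set_take_disj_set_drop_if_distinct[of w j j]
        by (auto simp: insert_letter_def dest: in_set_takeD in_set_dropD)
      then show "insert_letter j b w \<in> permutations_of_set (insert b S)"
        using \<open>set w = S\<close> by (intro permutations_of_setI) auto
    qed
    show "?R \<subseteq> ?L"
    proof
      fix v assume v: "v \<in> permutations_of_set (insert b S)"
      then have "b \<in> set v" by (auto dest: permutations_of_setD)
      then obtain p s where ps: "v = p @ b # s" by (meson split_list)
      have "p @ s \<in> permutations_of_set S"
        using permutations_of_setD[OF v] assms unfolding ps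
        by (intro permutations_of_setI) (auto simp: set_eq_iff)
      moreover have "length p \<le> card S"
        using length_finite_permutations_of_set[OF \<open>p @ s \<in> permutations_of_set S\<close>] by simp
      moreover have "v = insert_letter (length p) b (p @ s)"
        by (simp add: ps insert_letter_def)
      ultimately show "v \<in> ?L" by force
    qed
  qed
qed

lemma letter_0 [simp]: "letter w 0 = 0"
  by (simp add: letter_def)

lemma letter_end [simp]: "letter w (Suc (length w)) = 0"
  by (simp add: letter_def nth_append)

lemma letter_nth: "1 \<le> i \<Longrightarrow> i \<le> length w \<Longrightarrow> letter w i = w ! (i - 1)"
  by (auto simp: letter_def nth_append nth_Cons')

lemma letter_insert_letter:
  assumes "j \<le> length w" "i \<le> Suc (Suc (length w))"
  shows "letter (insert_letter j b w) i =
    (if i \<le> j then letter w i else if i = Suc j then b else letter w (i - 1))"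
proof -
  define L where "L = 0 # w @ [0]"
  have "0 # insert_letter j b w @ [0] = take (Suc j) L @ b # drop (Suc j) L"
    using assms(1) by (simp add: L_def insert_letter_def)
  moreover have "length (take (Suc j) L) = Suc j" "length L = Suc (Suc (length w))"
    using assms(1) by (simp_all add: L_def)
  moreover have "Suc (i - 2) = i - 1" if "\<not> i \<le> j" "i \<noteq> Suc j"
    using that by linarith
  ultimately show ?thesis
    using assms unfolding letter_def L_def[symmetric]
    by (auto simp: nth_append nth_Cons')
qed

text \<open>
  Since the letters are positive, the comparison with the zeros at both ends is strict too;
  so every position is a peak, a valley, a double ascent or a double descent.
\<close>

lemma letter_neq_Suc:
  assumes "distinct w" "0 \<notin> set w" "w \<noteq> []" "i \<le> length w"
  shows "letter w i \<noteq> letter w (Suc i)"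
proof -
  have pos: "letter w k \<noteq> 0" if "k \<in> {1..length w}" for k
  proof -
    have "letter w k \<in> set w" using that by (auto simp: letter_nth)
    then show ?thesis using assms(2) by metis
  qed
  consider "i = 0" | "i = length w" | "1 \<le> i" "i < length w" using assms(4) by linarith
  then show ?thesis
  proof cases
    case 1 then show ?thesis using pos[of 1] assms(3) by (simp add: Suc_le_eq)
  next
    case 2 then show ?thesis using pos[of i] assms(3) by (simp add: Suc_le_eq)
  next
    case 3 then show ?thesis
      using assms(1) by (auto simp: letter_nth nth_eq_iff_index_eq)
  qed
qed

locale min_insertion =
  fixes w :: "nat list" and b :: nat and j :: nat
  assumes distinct: "distinct w" and w_nonempty: "w \<noteq> []"
    and b_pos: "0 < b" and b_less: "\<And>a. a \<in> set w \<Longrightarrow> b < a"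
    and j_le: "j \<le> length w"
begin

abbreviation "v \<equiv> insert_letter j b w"

lemma b_less_letter: "i \<in> {1..length w} \<Longrightarrow> b < letter w i"
  by (auto simp: letter_nth intro!: b_less)

lemma letter_pos: "i \<in> {1..length w} \<Longrightarrow> 0 < letter w i"
  using b_less_letter by fastforce

lemma adjacent_distinct: "i \<le> length w \<Longrightarrow> letter w i \<noteq> letter w (Suc i)"
  using distinct w_nonempty b_pos b_less by (intro letter_neq_Suc) auto

lemma shift_pos_bounds: "i \<in> {1..length w} \<Longrightarrow> shift_pos j i \<in> {1..Suc (length w)}"
  by (auto simp: shift_pos_def)

lemma letter_shift: "i \<in> {1..length w} \<Longrightarrow> letter v (shift_pos j i) = letter w i"
  using j_le by (auto simp: shift_pos_def letter_insert_letter)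

lemma letter_shift_next:
  "i \<in> {1..length w} \<Longrightarrow> letter v (Suc (shift_pos j i)) = (if i = j then b else letter w (Suc i))"
  using j_le by (auto simp: shift_pos_def letter_insert_letter)

lemma letter_shift_prev:
  "i \<in> {1..length w} \<Longrightarrow>
    letter v (shift_pos j i - 1) = (if i = Suc j then b else letter w (i - 1))"
  using j_le by (auto simp: shift_pos_def letter_insert_letter)

lemma letter_new: "letter v (Suc j) = b" "letter v j = letter w j"
  "letter v (Suc (Suc j)) = letter w (Suc j)"
  using j_le by (auto simp: letter_insert_letter)

lemma positions_insert:
  "{1..length v} = insert (Suc j) (shift_pos j ` {1..length w})"
proof -
  have "i \<in> shift_pos j ` {1..length w}" if "i \<in> {1..Suc (length w)}" "i \<noteq> Suc j" for i
    using that j_le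
    by (intro image_eqI[of _ _ "if i \<le> j then i else i - 1"]) (auto simp: shift_pos_def)
  then have "{1..Suc (length w)} \<subseteq> insert (Suc j) (shift_pos j ` {1..length w})"
    by blast
  moreover have "insert (Suc j) (shift_pos j ` {1..length w}) \<subseteq> {1..Suc (length w)}"
    using j_le shift_pos_bounds by fastforce
  ultimately show ?thesis unfolding length_insert_letter by (rule equalityI)
qed

lemma inj_shift_pos: "inj_on (shift_pos j) A"
  by (auto simp: inj_on_def shift_pos_def split: if_splits)

lemma new_not_shifted: "Suc j \<notin> shift_pos j ` A"
  by (auto simp: shift_pos_def)

lemma ball_positions:
  "(\<forall>k\<in>{1..length v}. Q k) \<longleftrightarrow> Q (Suc j) \<and> (\<forall>k\<in>{1..length w}. Q (shift_pos j k))"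
  unfolding positions_insert by blast

lemma shift_pos_less_iff: "shift_pos j i < shift_pos j k \<longleftrightarrow> i < k"
  by (auto simp: shift_pos_def)

text \<open>
  The new letter is smaller than all others, so it cannot prevent any of them from being an
  extremal maximum.
\<close>

lemma is_lr_max_shift:
  assumes "i \<in> {1..length w}"
  shows "is_lr_max v (shift_pos j i) \<longleftrightarrow> is_lr_max w i"
proof -
  have "is_lr_max v (shift_pos j i) \<longleftrightarrow> (\<forall>k\<in>{1..length v}. k < shift_pos j i \<longrightarrow>
      letter v k < letter v (shift_pos j i))"
    using shift_pos_bounds[OF assms] unfolding is_lr_max_def by auto
  also have "\<dots> \<longleftrightarrow> is_lr_max w i"
    using assms b_less_letter[OF assms] unfolding ball_positions is_lr_max_def
    by (auto simp: letter_shift letter_new shift_pos_less_iff)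
  finally show ?thesis .
qed

lemma is_rl_max_shift:
  assumes "i \<in> {1..length w}"
  shows "is_rl_max v (shift_pos j i) \<longleftrightarrow> is_rl_max w i"
proof -
  have "is_rl_max v (shift_pos j i) \<longleftrightarrow> (\<forall>k\<in>{1..length v}. shift_pos j i < k \<longrightarrow>
      letter v k < letter v (shift_pos j i))"
    using shift_pos_bounds[OF assms] unfolding is_rl_max_def by auto
  also have "\<dots> \<longleftrightarrow> is_rl_max w i"
    using assms b_less_letter[OF assms] unfolding ball_positions is_rl_max_def
    by (auto simp: letter_shift letter_new shift_pos_less_iff)
  finally show ?thesis .
qed

lemma is_lr_max_new: "is_lr_max v (Suc j) \<longleftrightarrow> j = 0"
proof
  assume *: "is_lr_max v (Suc j)"
  show "j = 0"
  proof (rule ccontr)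
    assume "j \<noteq> 0"
    then have "letter v j < letter v (Suc j)"
      using * by (simp add: is_lr_max_def Suc_le_eq)
    then have "letter w j < b" by (simp add: letter_new)
    then show False using b_less_letter[of j] \<open>j \<noteq> 0\<close> j_le by auto
  qed
qed (auto simp: is_lr_max_def)

lemma is_rl_max_new: "is_rl_max v (Suc j) \<longleftrightarrow> j = length w"
proof
  assume *: "is_rl_max v (Suc j)"
  show "j = length w"
  proof (rule ccontr)
    assume "j \<noteq> length w"
    then have "letter v (Suc (Suc j)) < letter v (Suc j)"
      using * j_le by (simp add: is_rl_max_def)
    then have "letter w (Suc j) < b" by (simp add: letter_new)
    then show False using b_less_letter[of "Suc j"] \<open>j \<noteq> length w\<close> j_le by auto
  qed
qed (auto simp: is_rl_max_def)

lemma card_positions_insert: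
  "card {i \<in> {1..length v}. Q i} =
    of_bool (Q (Suc j)) + card {i \<in> {1..length w}. Q (shift_pos j i)}"
proof -
  have "{i \<in> {1..length v}. Q i} =
      (if Q (Suc j) then {Suc j} else {}) \<union> shift_pos j ` {i \<in> {1..length w}. Q (shift_pos j i)}"
    unfolding positions_insert by auto
  moreover have "card \<dots> = of_bool (Q (Suc j)) + card {i \<in> {1..length w}. Q (shift_pos j i)}"
    by (subst card_Un_disjoint)
       (use new_not_shifted in \<open>auto simp: card_image[OF inj_shift_pos]\<close>)
  ultimately show ?thesis by simp
qed

lemma lmax_insert: "lmax v = of_bool (j = 0) + lmax w"
proof -
  have "{i \<in> {1..length w}. is_lr_max v (shift_pos j i)} = {i \<in> {1..length w}. is_lr_max w i}"
    using is_lr_max_shift by blast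
  then show ?thesis
    unfolding lmax_def card_positions_insert is_lr_max_new by simp
qed

lemma rmax_insert: "rmax v = of_bool (j = length w) + rmax w"
proof -
  have "{i \<in> {1..length w}. is_rl_max v (shift_pos j i)} = {i \<in> {1..length w}. is_rl_max w i}"
    using is_rl_max_shift by blast
  then show ?thesis
    unfolding rmax_def card_positions_insert is_rl_max_new by simp
qed

end

text \<open>
  Together with \<open>rmax_pos\<close>, this ensures that the truncated subtraction in the exponent of
  \<open>\<alpha>\<close> commutes with adding the contribution of an inserted letter.
\<close>

lemma lmax_pos:
  assumes "w \<noteq> []" shows "1 \<le> lmax w"
proof -
  have "1 \<in> {i \<in> {1..length w}. is_lr_max w i}"
    using assms by (auto simp: is_lr_max_def Suc_le_eq)
  then have "{i \<in> {1..length w}. is_lr_max w i} \<noteq> {}" by blast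
  then show ?thesis unfolding lmax_def by (simp add: Suc_le_eq card_gt_0_iff)
qed

lemma rmax_pos:
  assumes "w \<noteq> []" shows "1 \<le> rmax w"
proof -
  have "length w \<in> {i \<in> {1..length w}. is_rl_max w i}"
    using assms by (auto simp: is_rl_max_def Suc_le_eq)
  then have "{i \<in> {1..length w}. is_rl_max w i} \<noteq> {}" by blast
  then show ?thesis unfolding rmax_def by (simp add: Suc_le_eq card_gt_0_iff)
qed

section \<open>How an insertion changes the weight of a word\<close>

text \<open>
  The weights \<open>c\<close> and \<open>c'\<close> of the maximal double ascents and double descents are separate
  parameters rather than multiples of \<open>u\<close> and \<open>u'\<close>: an insertion that affects a double
  ascent or double descent turns it into a peak, of weight \<open>1\<close>, so all of \<open>u, u', c, c'\<close> need the derivative \<open>1\<close>, which \<open>t * u\<close> would not have.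
\<close>

definition pos_weight :: "'a::comm_ring_1 \<Rightarrow> 'a \<Rightarrow> 'a \<Rightarrow> 'a \<Rightarrow> 'a \<Rightarrow> nat list \<Rightarrow> nat \<Rightarrow> 'a" where
  "pos_weight p u u' c c' w i =
    (if is_valley w i then p
     else if is_double_ascent w i then (if is_lr_max w i then c else u)
     else if is_double_descent w i then (if is_rl_max w i then c' else u')
     else 1)"

definition word_weight :: "'a::comm_ring_1 \<Rightarrow> 'a \<Rightarrow> 'a \<Rightarrow> 'a \<Rightarrow> 'a \<Rightarrow> 'a \<Rightarrow> nat list \<Rightarrow> 'a" where
  "word_weight \<alpha> p u u' c c' w =
    \<alpha> ^ (lmax w + rmax w - 2) * (\<Prod>i=1..length w. pos_weight p u u' c c' w i)"

context min_insertion
begin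

lemma prod_positions_insert:
  "(\<Prod>i=1..length v. f i) = f (Suc j) * (\<Prod>i=1..length w. f (shift_pos j i))"
  unfolding positions_insert
  by (subst prod.insert) (use new_not_shifted in \<open>auto simp: prod.reindex inj_shift_pos\<close>)

lemma pos_weight_shift_far:
  assumes "i \<in> {1..length w}" "i \<noteq> j" "i \<noteq> Suc j"
  shows "pos_weight p u u' c c' v (shift_pos j i) = pos_weight p u u' c c' w i"
  using assms letter_shift_prev[of i] letter_shift_next[of i]
  by (simp add: pos_weight_def is_valley_def is_double_ascent_def is_double_descent_def
      letter_shift is_lr_max_shift is_rl_max_shift)

text \<open>
  Below a larger left neighbour, replacing that neighbour by the smaller new letter turns a
  valley into a double ascent and a double descent into a peak.  The valley does not become
  a maximal double ascent, since the former neighbour is still to its left.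
\<close>

lemma pos_weight_shift_next:
  assumes "Suc j \<le> length w"
  shows "pos_weight p u u' c c' v (shift_pos j (Suc j)) =
    (if letter w j < letter w (Suc j) then pos_weight p u u' c c' w (Suc j)
     else if is_valley w (Suc j) then u else 1)"
proof -
  have i: "Suc j \<in> {1..length w}" using assms by simp
  have nl: "\<not> is_lr_max w (Suc j)" if "\<not> letter w j < letter w (Suc j)"
    using that letter_pos[OF i] unfolding is_lr_max_def
    by (cases "j = 0") (auto intro!: exI[of _ j])
  show ?thesis
    using letter_shift_prev[OF i] letter_shift_next[OF i] letter_shift[OF i] nl
      b_less_letter[OF i] adjacent_distinct[OF j_le] adjacent_distinct[OF assms]
    by (simp add: pos_weight_def is_valley_def is_double_ascent_def is_double_descent_def
      is_lr_max_shift[OF i] is_rl_max_shift[OF i])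
qed

lemma pos_weight_shift_prev:
  assumes "1 \<le> j"
  shows "pos_weight p u u' c c' v (shift_pos j j) =
    (if letter w (Suc j) < letter w j then pos_weight p u u' c c' w j
     else if is_valley w j then u' else 1)"
proof -
  have i: "j \<in> {1..length w}" using assms j_le by simp
  have nl: "\<not> is_rl_max w j" if "\<not> letter w (Suc j) < letter w j"
    using that letter_pos[OF i] j_le unfolding is_rl_max_def
    by (cases "j = length w") (auto intro!: exI[of _ "Suc j"])
  have "letter w (j - 1) \<noteq> letter w j"
    using adjacent_distinct[of "j - 1"] assms j_le by simp
  then show ?thesis
    using letter_shift_prev[OF i] letter_shift_next[OF i] letter_shift[OF i] nl
      b_less_letter[OF i] adjacent_distinct[OF j_le]
    by (simp add: pos_weight_def is_valley_def is_double_ascent_def is_double_descent_def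
      is_lr_max_shift[OF i] is_rl_max_shift[OF i])
qed

lemma pos_weight_new:
  "pos_weight p u u' c c' v (Suc j) = (if j = 0 then c else if j = length w then c' else p)"
proof -
  have "b < letter w j" if "j \<noteq> 0"
    using that j_le by (intro b_less_letter) auto
  moreover have "b < letter w (Suc j)" if "j \<noteq> length w"
    using that j_le by (intro b_less_letter) auto
  ultimately show ?thesis
    using b_pos w_nonempty letter_new is_lr_max_new is_rl_max_new
    by (auto simp: pos_weight_def is_valley_def is_double_ascent_def is_double_descent_def)
qed

lemma prod_pos_weight_first:
  assumes "j = 0"
  shows "(\<Prod>i=1..length w. pos_weight p u u' c c' v (shift_pos j i)) =
    (\<Prod>i=1..length w. pos_weight p u u' c c' w i)"
proof (rule prod.cong)
  fix i assume i: "i \<in> {1..length w}"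
  show "pos_weight p u u' c c' v (shift_pos j i) = pos_weight p u u' c c' w i"
  proof (cases "i = Suc j")
    case True
    then show ?thesis
      using pos_weight_shift_next[of p u u' c c'] letter_pos[OF i] i assms by simp
  next
    case False
    then show ?thesis using pos_weight_shift_far[OF i] i assms by simp
  qed
qed simp

lemma prod_pos_weight_last:
  assumes "j = length w"
  shows "(\<Prod>i=1..length w. pos_weight p u u' c c' v (shift_pos j i)) =
    (\<Prod>i=1..length w. pos_weight p u u' c c' w i)"
proof (rule prod.cong)
  fix i assume i: "i \<in> {1..length w}"
  show "pos_weight p u u' c c' v (shift_pos j i) = pos_weight p u u' c c' w i"
  proof (cases "i = j")
    case True
    then show ?thesis
      using pos_weight_shift_prev[of p u u' c c'] letter_pos[OF i] i assms by simp
  next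
    case False
    then show ?thesis using pos_weight_shift_far[OF i] i assms by simp
  qed
qed simp

text \<open>
  Only one of the two neighbours of the new letter changes its type: the smaller one, whose
  factor is split off from the product.
\<close>

lemma prod_pos_weight_interior:
  fixes p u u' c c' :: "'a::comm_ring_1"
  assumes "1 \<le> j" "j < length w"
  defines "rest \<equiv> \<lambda>i. \<Prod>k\<in>{1..length w} - {i}. pos_weight p u u' c c' w k"
  shows "(\<Prod>i=1..length w. pos_weight p u u' c c' v (shift_pos j i)) =
    (if letter w j < letter w (Suc j) then rest j * (if is_valley w j then u' else 1)
     else rest (Suc j) * (if is_valley w (Suc j) then u else 1))"
proof (cases "letter w j < letter w (Suc j)")
  case True
  have "(\<Prod>k\<in>{1..length w} - {j}. pos_weight p u u' c c' v (shift_pos j k)) = rest j"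
    unfolding rest_def
  proof (rule prod.cong)
    fix i assume i: "i \<in> {1..length w} - {j}"
    show "pos_weight p u u' c c' v (shift_pos j i) = pos_weight p u u' c c' w i"
    proof (cases "i = Suc j")
      case eq: True
      show ?thesis
        unfolding eq by (subst pos_weight_shift_next) (use True assms(1,2) in simp_all)
    next
      case False
      then show ?thesis
        using i by (intro pos_weight_shift_far) simp_all
    qed
  qed simp
  then show ?thesis
    using True assms(1,2)
    by (subst prod.remove[of _ j]) (simp_all add: pos_weight_shift_prev mult.commute)
next
  case False
  then have desc: "letter w (Suc j) < letter w j"
    using adjacent_distinct[OF j_le] by simp
  have "(\<Prod>k\<in>{1..length w} - {Suc j}. pos_weight p u u' c c' v (shift_pos j k)) = rest (Suc j)"
    unfolding rest_def
  proof (rule prod.cong)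
    fix i assume i: "i \<in> {1..length w} - {Suc j}"
    show "pos_weight p u u' c c' v (shift_pos j i) = pos_weight p u u' c c' w i"
    proof (cases "i = j")
      case eq: True
      show ?thesis
        unfolding eq by (subst pos_weight_shift_prev) (use desc assms(1,2) in simp_all)
    next
      case False
      then show ?thesis
        using i by (intro pos_weight_shift_far) simp_all
    qed
  qed simp
  then show ?thesis
    using False assms(1,2)
    by (subst prod.remove[of _ "Suc j"]) (simp_all add: pos_weight_shift_next mult.commute)
qed

lemma word_weight_insert:
  "word_weight \<alpha> p u u' c c' v =
    (if j = 0 then \<alpha> * c * word_weight \<alpha> p u u' c c' w
     else if j = length w then \<alpha> * c' * word_weight \<alpha> p u u' c c' w
     else \<alpha> ^ (lmax w + rmax w - 2) * p *
       (\<Prod>i=1..length w. pos_weight p u u' c c' v (shift_pos j i)))"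
proof -
  have e: "1 + (lmax w + rmax w) - 2 = Suc (lmax w + rmax w - 2)"
    using lmax_pos[OF w_nonempty] rmax_pos[OF w_nonempty] by simp
  have "word_weight \<alpha> p u u' c c' v =
      \<alpha> ^ (of_bool (j = 0) + lmax w + (of_bool (j = length w) + rmax w) - 2) *
      ((if j = 0 then c else if j = length w then c' else p) *
      (\<Prod>i=1..length w. pos_weight p u u' c c' v (shift_pos j i)))"
    by (simp only: word_weight_def lmax_insert rmax_insert prod_positions_insert pos_weight_new)
  then have eq: "word_weight \<alpha> p u u' c c' v =
      \<alpha> ^ (of_bool (j = 0) + of_bool (j = length w) + (lmax w + rmax w) - 2) *
      (if j = 0 then c else if j = length w then c' else p) *
      (\<Prod>i=1..length w. pos_weight p u u' c c' v (shift_pos j i))"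
    by (simp only: ac_simps)
  consider "j = 0" "j \<noteq> length w" | "j \<noteq> 0" "j = length w" | "j \<noteq> 0" "j \<noteq> length w"
    using w_nonempty by fastforce
  then show ?thesis
  proof cases
    case 1
    then have "word_weight \<alpha> p u u' c c' v =
        \<alpha> ^ Suc (lmax w + rmax w - 2) * c * (\<Prod>i=1..length w. pos_weight p u u' c c' w i)"
      unfolding eq prod_pos_weight_first[OF 1(1)]
      by (simp only: of_bool_eq add_0 add_0_right e if_True simp_thms)
    then show ?thesis
      using 1(1) by (simp only: simp_thms if_True word_weight_def[of _ _ _ _ _ _ w] power_Suc ac_simps)
  next
    case 2
    then have "word_weight \<alpha> p u u' c c' v =
        \<alpha> ^ Suc (lmax w + rmax w - 2) * c' * (\<Prod>i=1..length w. pos_weight p u u' c c' w i)"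
      unfolding eq prod_pos_weight_last[OF 2(2)]
      by (simp only: of_bool_eq add_0 add_0_right e if_True if_False simp_thms)
    then show ?thesis
      using 2 by (simp only: simp_thms if_True if_False word_weight_def[of _ _ _ _ _ _ w]
          power_Suc ac_simps)
  next
    case 3
    then show ?thesis unfolding eq by simp
  qed
qed

end

lemma fps_deriv_prod:
  fixes f :: "'b \<Rightarrow> 'a::comm_ring_1 fps"
  assumes "finite A"
  shows "fps_deriv (prod f A) = (\<Sum>a\<in>A. prod f (A - {a}) * fps_deriv (f a))"
  using assms
proof (induction A)
  case (insert x A)
  have "prod f (insert x A - {a}) = f x * prod f (A - {a})" if "a \<in> A" for a
  proof -
    have "insert x A - {a} = insert x (A - {a})" using that insert by auto
    then show ?thesis using insert by simp
  qed
  then show ?case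
    using insert by (simp add: sum_distrib_left mult_ac cong: sum.cong)
qed simp

lemma fps_deriv_power_eq_0:
  fixes a :: "'a::comm_ring_1 fps"
  shows "fps_deriv a = 0 \<Longrightarrow> fps_deriv (a ^ k) = 0"
  by (induction k) auto

text \<open>
  The two ends give the term with \<open>\<alpha> * (c + c')\<close>.  For the interior gaps, the sum over the
  gaps is reorganised into a sum over the positions whose type changes, and the changes at
  one position add up to the derivative of its weight.  The result is the product rule for
  the product of the weights.
\<close>

lemma sum_word_weight_insert:
  fixes \<alpha> p u u' c c' :: "'a::comm_ring_1 fps"
  assumes w: "distinct w" "w \<noteq> []" and b: "0 < b" "\<And>a. a \<in> set w \<Longrightarrow> b < a"
    and deriv: "fps_deriv \<alpha> = 0" "fps_deriv p = u + u'" "fps_deriv u = 1" "fps_deriv u' = 1"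
      "fps_deriv c = 1" "fps_deriv c' = 1"
  shows "(\<Sum>j\<le>length w. word_weight \<alpha> p u u' c c' (insert_letter j b w)) =
    \<alpha> * (c + c') * word_weight \<alpha> p u u' c c' w + p * fps_deriv (word_weight \<alpha> p u u' c c' w)"
proof -
  define m where "m = length w"
  define q where "q = pos_weight p u u' c c' w"
  define rest where "rest i = (\<Prod>k\<in>{1..m} - {i}. q k)" for i
  \<comment> \<open>The effect on position \<open>i\<close> of an insertion directly after it (\<open>up\<close>) or directly before
    it (\<open>down\<close>); \<open>0\<close> if position \<open>i\<close> is not the smaller neighbour.\<close>
  define up where "up i = (if letter w i < letter w (Suc i)
    then rest i * (if is_valley w i then u' else 1) else 0)" for i
  define down where "down i = (if letter w i < letter w (i - 1)
    then rest i * (if is_valley w i then u else 1) else 0)" for i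
  define e where "e = \<alpha> ^ (lmax w + rmax w - 2)"
  let ?W = "word_weight \<alpha> p u u' c c'"
  have mi: "min_insertion w b j" if "j \<le> m" for j
    using w b that unfolding m_def by unfold_locales auto
  have m: "1 \<le> m" using w by (simp add: m_def Suc_le_eq)
  have ends: "?W (insert_letter 0 b w) = \<alpha> * c * ?W w" "?W (insert_letter m b w) = \<alpha> * c' * ?W w"
    using min_insertion.word_weight_insert[OF mi, of 0 \<alpha> p u u' c c']
      min_insertion.word_weight_insert[OF mi, of m \<alpha> p u u' c c'] m
    by (simp_all add: m_def w)
  have interior: "?W (insert_letter j b w) = e * p * (up j + down (Suc j))"
    if j: "j \<in> {1..<m}" for j
  proof -
    interpret min_insertion w b j using mi j by simp
    have "(\<Prod>i=1..length w. pos_weight p u u' c c' v (shift_pos j i)) = up j + down (Suc j)"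
      using j adjacent_distinct[OF j_le]
      by (subst prod_pos_weight_interior) (auto simp: up_def down_def rest_def q_def m_def)
    moreover have "j \<noteq> 0" "j \<noteq> length w" using j by (auto simp: m_def)
    ultimately show ?thesis
      unfolding word_weight_insert e_def by (simp only: if_False)
  qed
  have up_down: "up i + down i = rest i * fps_deriv (q i)" if i: "i \<in> {1..m}" for i
  proof -
    interpret min_insertion w b i using mi i by simp
    have "letter w i \<noteq> letter w (Suc i)" "letter w (i - 1) \<noteq> letter w i"
      using adjacent_distinct[of i] adjacent_distinct[of "i - 1"] i by (simp_all add: m_def le_diff_conv)
    then show ?thesis
      by (auto simp: up_def down_def q_def pos_weight_def is_valley_def is_double_ascent_def
          is_double_descent_def deriv algebra_simps)
  qed
  \<comment> \<open>The sums over the interior gaps extend to all positions, since the boundary letters \<open>0\<close>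
    make the additional terms vanish.\<close>
  have "up m = 0" by (simp add: up_def m_def)
  then have up: "(\<Sum>j\<in>{1..<m}. up j) = (\<Sum>i=1..m. up i)"
    using m by (simp add: atLeastLessThanSuc_atLeastAtMost[symmetric])
  have "down 1 = 0" by (simp add: down_def)
  moreover have "(\<Sum>j\<in>{1..<m}. down (Suc j)) = (\<Sum>i\<in>{Suc 1..m}. down i)"
    by (simp add: sum.shift_bounds_Suc_ivl[symmetric] atLeastLessThanSuc_atLeastAtMost[symmetric])
  ultimately have down: "(\<Sum>j\<in>{1..<m}. down (Suc j)) = (\<Sum>i=1..m. down i)"
    using m by (simp add: sum.atLeast_Suc_atMost)
  have "{..m} = insert 0 (insert m {1..<m})" using m by auto
  then have "(\<Sum>j\<le>m. ?W (insert_letter j b w)) =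
      \<alpha> * c * ?W w + (\<alpha> * c' * ?W w + (\<Sum>j\<in>{1..<m}. e * p * (up j + down (Suc j))))"
    using m ends interior by simp
  also have "(\<Sum>j\<in>{1..<m}. e * p * (up j + down (Suc j))) = e * p * (\<Sum>i=1..m. up i + down i)"
    by (simp only: sum_distrib_left[symmetric] sum.distrib up down)
  also have "(\<Sum>i=1..m. up i + down i) = fps_deriv (\<Prod>i=1..m. q i)"
    by (simp add: up_down fps_deriv_prod rest_def)
  also have "e * p * fps_deriv (\<Prod>i=1..m. q i) = p * fps_deriv (?W w)"
    unfolding word_weight_def e_def[symmetric] q_def[symmetric] m_def[symmetric]
    by (simp add: e_def fps_deriv_power_eq_0 deriv mult_ac)
  finally show ?thesis by (simp add: m_def algebra_simps)
qed

section \<open>The recurrence for the sum of all weights\<close>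

text \<open>
  The arguments are the valley weight and the sum of the two weights of the maximal double
  ascents and double descents; the individual weights do not appear.
\<close>

fun eulerian_fps :: "'a::comm_ring_1 fps \<Rightarrow> 'a fps \<Rightarrow> 'a fps \<Rightarrow> nat \<Rightarrow> 'a fps" where
  "eulerian_fps \<alpha> p s 0 = 1"
| "eulerian_fps \<alpha> p s (Suc n) =
    \<alpha> * s * eulerian_fps \<alpha> p s n + p * fps_deriv (eulerian_fps \<alpha> p s n)"

lemma word_weight_singleton:
  assumes "0 < a" shows "word_weight \<alpha> p u u' c c' [a] = 1"
proof -
  have "{i \<in> {1..length [a]}. is_lr_max [a] i} = {1}"
    "{i \<in> {1..length [a]}. is_rl_max [a] i} = {1}"
    by (auto simp: is_lr_max_def is_rl_max_def)
  then have "lmax [a] = 1" "rmax [a] = 1"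
    by (simp_all only: lmax_def rmax_def card_1_singleton_iff) auto
  then show ?thesis
    using assms by (simp add: word_weight_def pos_weight_def is_valley_def is_double_ascent_def
      is_double_descent_def letter_def)
qed

text \<open>
  A word on \<open>insert b S\<close> is a word on \<open>S\<close> together with a gap for \<open>b\<close>, so taking the elements
  of \<open>S\<close> in decreasing order turns the effect of one insertion into the recurrence.
\<close>

lemma sum_word_weight:
  fixes \<alpha> p u u' c c' :: "'a::comm_ring_1 fps"
  assumes S: "finite S" "S \<noteq> {}" "0 \<notin> S"
    and deriv: "fps_deriv \<alpha> = 0" "fps_deriv p = u + u'" "fps_deriv u = 1" "fps_deriv u' = 1"
      "fps_deriv c = 1" "fps_deriv c' = 1"
  shows "(\<Sum>w\<in>permutations_of_set S. word_weight \<alpha> p u u' c c' w) =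
    eulerian_fps \<alpha> p (c + c') (card S - 1)"
  using S
proof (induction S rule: finite_linorder_min_induct)
  case (insert b S)
  let ?W = "word_weight \<alpha> p u u' c c'"
  let ?F = "eulerian_fps \<alpha> p (c + c')"
  have b: "b \<notin> S" "0 < b" using insert by auto
  show ?case
  proof (cases "S = {}")
    case True
    then show ?thesis using b by (simp add: word_weight_singleton)
  next
    case False
    then have card: "card S = Suc (card S - 1)"
      using insert by (simp add: card_gt_0_iff)
    have step: "(\<Sum>j\<le>card S. ?W (insert_letter j b w)) =
        \<alpha> * (c + c') * ?W w + p * fps_deriv (?W w)" if w: "w \<in> permutations_of_set S" for w
      using permutations_of_setD[OF w] length_finite_permutations_of_set[OF w]
        sum_word_weight_insert[of w b \<alpha> p u u' c c'] insert.hyps b False deriv by auto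
    have "(\<Sum>w\<in>permutations_of_set (insert b S). ?W w) =
        (\<Sum>(w, j)\<in>permutations_of_set S \<times> {..card S}. ?W (insert_letter j b w))"
      using sum.reindex_bij_betw[OF bij_betw_insert_letter, of S b ?W] insert b
      by (simp add: case_prod_unfold)
    also have "\<dots> = (\<Sum>w\<in>permutations_of_set S. \<Sum>j\<le>card S. ?W (insert_letter j b w))"
      by (simp add: sum.cartesian_product)
    also have "\<dots> = \<alpha> * (c + c') * (\<Sum>w\<in>permutations_of_set S. ?W w)
        + p * fps_deriv (\<Sum>w\<in>permutations_of_set S. ?W w)"
      by (simp add: step sum.distrib sum_distrib_left fps_deriv_sum)
    also have "(\<Sum>w\<in>permutations_of_set S. ?W w) = ?F (card S - 1)"
      using insert False by simp
    also have "\<alpha> * (c + c') * ?F (card S - 1) + p * fps_deriv (?F (card S - 1)) = ?F (card S)"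
      by (subst (3) card) (simp only: eulerian_fps.simps)
    finally show ?thesis using insert b by simp
  qed
qed simp

text \<open>
  Setting the variable to \<open>0\<close> is a ring homomorphism, so it acts on the parameters.
\<close>

lemma word_weight_nth_0:
  "fps_nth (word_weight \<alpha> p u u' c c' w) 0 =
    word_weight (fps_nth \<alpha> 0) (fps_nth p 0) (fps_nth u 0) (fps_nth u' 0)
      (fps_nth c 0) (fps_nth c' 0) w"
proof -
  have prod0: "fps_nth (\<Prod>i\<in>A. f i) 0 = (\<Prod>i\<in>A. fps_nth (f i) 0)"
    for A :: "nat set" and f :: "nat \<Rightarrow> 'a fps"
    by (induction A rule: infinite_finite_induct) auto
  show ?thesis
    by (simp add: word_weight_def prod0 fps_power_zeroth pos_weight_def if_distrib[of "\<lambda>f. fps_nth f 0"]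
        cong: if_cong)
qed

lemma prod_if_eq_power_card:
  fixes a :: "'a::comm_monoid_mult"
  shows "finite A \<Longrightarrow> (\<Prod>i\<in>A. if Q i then a else 1) = a ^ card {i \<in> A. Q i}"
  by (simp flip: prod.inter_filter)

lemma word_weight_eq_monomial:
  "word_weight \<alpha> p u u' (t * u) (t * u') w =
    p ^ val w * u ^ da w * u' ^ dd w * t ^ (lmaxda w + rmaxdd w) * \<alpha> ^ (lmax w + rmax w - 2)"
proof -
  have "(\<Prod>i=1..length w. pos_weight p u u' (t * u) (t * u') w i) =
    (\<Prod>i=1..length w. (if is_valley w i then p else 1) * (if is_double_ascent w i then u else 1)
      * (if is_double_descent w i then u' else 1)
      * (if is_lr_max w i \<and> is_double_ascent w i then t else 1)
      * (if is_rl_max w i \<and> is_double_descent w i then t else 1))"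
    by (rule prod.cong)
       (auto simp: pos_weight_def is_valley_def is_double_ascent_def is_double_descent_def)
  then show ?thesis
    by (simp add: word_weight_def prod.distrib prod_if_eq_power_card power_add mult_ac
        val_def da_def dd_def lmaxda_def rmaxdd_def)
qed

text \<open>
  On the right-hand side \<open>u\<close> and \<open>u'\<close> occur only in \<open>u + u'\<close>, which is the reason for the
  theorem.
\<close>

lemma weighted_sum_eq_eulerian_fps:
  fixes \<alpha> p u u' t :: "'a::comm_ring_1"
  assumes S: "finite S" "S \<noteq> {}" "0 \<notin> S"
  shows "(\<Sum>w\<in>permutations_of_set S. p ^ val w * u ^ da w * u' ^ dd w
      * t ^ (lmaxda w + rmaxdd w) * \<alpha> ^ (lmax w + rmax w - 2)) =
    fps_nth (eulerian_fps (fps_const \<alpha>)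
      (fps_const p + fps_const (u + u') * fps_X + fps_X ^ 2)
      (fps_const (t * (u + u')) + 2 * fps_X) (card S - 1)) 0"
proof -
  \<comment> \<open>For the derivation \<open>p * d/dX\<close>, all of \<open>u, u', t * u, t * u'\<close> must flow with the same
    velocity \<open>p\<close>, so each is translated by \<open>X\<close>.  Then \<open>P\<close> has to be an antiderivative of
    \<open>lift u + lift u'\<close> with constant term \<open>p\<close>.\<close>
  define P where "P = fps_const p + fps_const (u + u') * fps_X + fps_X ^ 2"
  define lift where "lift a = fps_const a + fps_X" for a :: 'a
  have "fps_deriv P = lift u + lift u'"
    by (simp add: P_def lift_def power2_eq_square algebra_simps flip: fps_const_add)
  then have "(\<Sum>w\<in>permutations_of_set S. word_weight (fps_const \<alpha>) P (lift u) (lift u')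
        (lift (t * u)) (lift (t * u')) w)
      = eulerian_fps (fps_const \<alpha>) P (lift (t * u) + lift (t * u')) (card S - 1)" (is "?L = ?R")
    using S by (intro sum_word_weight) (auto simp: lift_def)
  then have "fps_nth ?L 0 = fps_nth ?R 0" by simp
  moreover have lift0: "fps_nth (lift a) 0 = a" for a
    by (simp add: lift_def)
  moreover have "lift (t * u) + lift (t * u') = fps_const (t * (u + u')) + 2 * fps_X"
    by (simp add: lift_def algebra_simps flip: fps_const_add)
  ultimately show ?thesis
    by (simp only: fps_sum_nth word_weight_nth_0 lift0 word_weight_eq_monomial)
       (simp add: P_def word_weight_eq_monomial)
qed

section \<open>Ascents and descents in terms of valleys\<close>

text \<open>
  The left end of an ascent is a valley or a double ascent.  Conversely, a valley or double
  ascent is never the last letter, as the boundary letter \<open>0\<close> after it would have to be larger.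
\<close>

lemma asc_eq_val_plus_da:
  assumes "distinct w" "0 \<notin> set w" "w \<noteq> []"
  shows "asc w = val w + da w"
proof -
  have "letter w (i - 1) \<noteq> letter w i" if "i \<in> {1..length w}" for i
    using that letter_neq_Suc[OF assms, of "i - 1"] by (simp add: le_diff_conv)
  moreover have "i \<noteq> length w" if "letter w i < letter w (i + 1)" for i
    using that by auto
  ultimately have "{i. 1 \<le> i \<and> i < length w \<and> letter w i < letter w (i + 1)} =
      {i \<in> {1..length w}. is_valley w i} \<union> {i \<in> {1..length w}. is_double_ascent w i}"
    by (fastforce simp: is_valley_def is_double_ascent_def)
  also have "card \<dots> = val w + da w"
    unfolding val_def da_def
    by (subst card_Un_disjoint) (auto simp: is_valley_def is_double_ascent_def)
  finally show ?thesis by (simp add: asc_def)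
qed

text \<open>
  Descents are counted by their right ends, one position after the one recorded by \<open>des\<close>.
\<close>

lemma des_eq_val_plus_dd:
  assumes "distinct w" "0 \<notin> set w" "w \<noteq> []"
  shows "des w = val w + dd w"
proof -
  have neq: "letter w (i + 1) \<noteq> letter w i" if "i \<in> {1..length w}" for i
    using that letter_neq_Suc[OF assms, of i] by auto
  have not_first: "i \<noteq> 1" if "letter w i < letter w (i - 1)" for i
    using that by auto
  have "i \<in> Suc ` {i. 1 \<le> i \<and> i < length w \<and> letter w i > letter w (i + 1)}"
    if "i \<in> {1..length w}" "letter w i < letter w (i - 1)" for i
    using that not_first[of i] by (intro image_eqI[of _ _ "i - 1"]) auto
  then have "Suc ` {i. 1 \<le> i \<and> i < length w \<and> letter w i > letter w (i + 1)} =
      {i \<in> {1..length w}. letter w i < letter w (i - 1)}"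
    by auto
  also have "\<dots> = {i \<in> {1..length w}. is_valley w i} \<union> {i \<in> {1..length w}. is_double_descent w i}"
    using neq by (fastforce simp: is_valley_def is_double_descent_def)
  also have "card \<dots> = val w + dd w"
    unfolding val_def dd_def
    by (subst card_Un_disjoint) (auto simp: is_valley_def is_double_descent_def)
  finally show ?thesis by (simp add: des_def card_image)
qed

theorem theorem2p2:
  fixes x y t \<alpha> u\<^sub>1 u\<^sub>2 u\<^sub>3 u\<^sub>4 :: "'a::comm_ring_1" and n :: nat
  assumes "x * y = u\<^sub>1 * u\<^sub>2"
    and "x + y = u\<^sub>3 + u\<^sub>4"
  shows "alpha_t_eulerian n x y t \<alpha> =
    (\<Sum>w\<in>permutations_of_set {1..n + 1}.
       (u\<^sub>1 * u\<^sub>2) ^ val w * u\<^sub>3 ^ da w * u\<^sub>4 ^ dd w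
       * t ^ (lmaxda w + rmaxdd w) * \<alpha> ^ (lmax w + rmax w - 2))"
proof -
  have "alpha_t_eulerian n x y t \<alpha> =
    (\<Sum>w\<in>permutations_of_set {1..n + 1}. (x * y) ^ val w * x ^ da w * y ^ dd w
       * t ^ (lmaxda w + rmaxdd w) * \<alpha> ^ (lmax w + rmax w - 2))"
    unfolding alpha_t_eulerian_def
  proof (rule sum.cong)
    fix w assume w: "w \<in> permutations_of_set {1..n + 1}"
    have "distinct w" "0 \<notin> set w" "w \<noteq> []"
      using permutations_of_setD[OF w] by auto
    then show "x ^ asc w * y ^ des w * t ^ (lmaxda w + rmaxdd w) * \<alpha> ^ (lmax w + rmax w - 2) =
        (x * y) ^ val w * x ^ da w * y ^ dd w
          * t ^ (lmaxda w + rmaxdd w) * \<alpha> ^ (lmax w + rmax w - 2)"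
      by (simp add: asc_eq_val_plus_da des_eq_val_plus_dd power_add power_mult_distrib mult_ac)
  qed simp
  also have "\<dots> = (\<Sum>w\<in>permutations_of_set {1..n + 1}.
       (u\<^sub>1 * u\<^sub>2) ^ val w * u\<^sub>3 ^ da w * u\<^sub>4 ^ dd w
       * t ^ (lmaxda w + rmaxdd w) * \<alpha> ^ (lmax w + rmax w - 2))"
    by (subst (1 2) weighted_sum_eq_eulerian_fps) (simp_all add: assms)
  finally show ?thesis .
qed

end
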